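(* Let $n\ge 3$, let $Y_1,\dots,Y_n$ be independent standard normal random variables and $\overline Y=(Y_1+\cdots+Y_n)/n$. For $0\le k\le n$ let \[ q_k=\mathbb P\big[\,Y_1,\dots,Y_k\le \overline Y\le Y_{k+1},\dots,Y_n\,\big], \] the probability that the sample mean is at least each of the first $k$ samples and at most each of the last $n-k$ samples. Then $(q_0,\dots,q_n)$ is log-concave: $q_k^2\ge q_{k+1}q_{k-1}$ for every $k\in\{1,\dots,n-1\}$. *)

theory Defs
  imports "HOL-Probability.Probability"
begin

definition sample_mean :: "nat \<Rightarrow> (nat \<Rightarrow> 'a \<Rightarrow> real) \<Rightarrow> 'a \<Rightarrow> real" where
  "sample_mean n Y \<omega> = (\<Sum>i=1..n. Y i \<omega>) / real n"

definition mean_rank_prob :: "'a measure \<Rightarrow> nat \<Rightarrow> (nat \<Rightarrow> 'a \<Rightarrow> real) \<Rightarrow> nat \<Rightarrow> real" where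
  "mean_rank_prob M n Y k = measure M
     {\<omega> \<in> space M. (\<forall>i\<in>{1..k}. Y i \<omega> \<le> sample_mean n Y \<omega>) \<and>
                   (\<forall>i\<in>{k+1..n}. sample_mean n Y \<omega> \<le> Y i \<omega>)}"

text \<open>Log-concavity of the finite sequence \<open>q 0, \<dots>, q n\<close>; values of \<open>q\<close> beyond \<open>n\<close> are irrelevant.
  Absence of internal zeros is not part of the notion.\<close>

definition log_concave_upto :: "nat \<Rightarrow> (nat \<Rightarrow> real) \<Rightarrow> bool" where
  "log_concave_upto n q \<longleftrightarrow> (\<forall>k\<in>{1..n-1}. (q k)\<^sup>2 \<ge> q (k+1) * q (k-1))"

end

theory Submission
  imports Defs
begin

text \<open>
  Substituting the mean \<open>m\<close> for one coordinate \<open>y\<^sub>j\<close> and recentring the others at \<open>m\<close> factors the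
  Gaussian density: up to a constant independent of \<open>k\<close>, \<open>q\<^sub>k\<close> is the value at \<open>0\<close> of the convolution of
  \<open>n\<close> half-normal densities, \<open>k\<close> of them on the negative and \<open>n - k\<close> on the positive half-line.
  Keeping the factors \<open>k\<close> and \<open>k + 1\<close> apart, and writing \<open>g\<close> for the half-normal density and \<open>G\<close> for
  the convolution of the remaining factors (there is one because \<open>n \<ge> 3\<close>), the numbers
  \<open>q\<^bsub>k+1\<^esub>\<close>, \<open>q\<^sub>k\<close>, \<open>q\<^bsub>k-1\<^esub>\<close> are proportional to the integrals of \<open>g(a) g(b)\<close> against
  \<open>G(a + b)\<close>, \<open>G(a - b)\<close>, \<open>G(- a - b)\<close> over \<open>a, b \<ge> 0\<close>.  As a convolution of log-concave
  functions \<open>G\<close> is log-concave, so \<open>G(a + b) G(- c - d) \<le> G(a - d) G(b - c)\<close> for nonnegative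
  \<open>a, b, c, d\<close>, because both sides have the same sum of arguments and those on the right lie between
  those on the left; integrating this gives the claim.
\<close>

section \<open>Total positivity of order 2 under convolution\<close>

text \<open>
  Log-concavity in the form of total positivity of order 2 of the kernel \<open>f (x - y)\<close>, which passes
  to convolutions by symmetrization, without the Prekopa--Leindler inequality.
\<close>

definition PF2 :: "(real \<Rightarrow> ennreal) \<Rightarrow> bool" where
  "PF2 f \<longleftrightarrow> (\<forall>x1 x2 y1 y2. x1 \<le> x2 \<longrightarrow> y1 \<le> y2 \<longrightarrow>
     f (x1 - y2) * f (x2 - y1) \<le> f (x1 - y1) * f (x2 - y2))"

lemma PF2D:
  "PF2 f \<Longrightarrow> x1 \<le> x2 \<Longrightarrow> y1 \<le> y2 \<Longrightarrow> f (x1 - y2) * f (x2 - y1) \<le> f (x1 - y1) * f (x2 - y2)"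
  by (simp add: PF2_def)

text \<open>Subtraction-free form of \<open>(p - p') * (q - q') \<ge> 0\<close>, valid at infinite
  values too: the right side is the left side plus \<open>a * b\<close>, with \<open>a\<close> and
  \<open>b\<close> the excesses of \<open>p\<close> over \<open>p'\<close> and of \<open>q\<close>
  over \<open>q'\<close>.\<close>

lemma ennreal_rearrangement:
  fixes p p' q q' :: ennreal
  assumes "p' \<le> p" "q' \<le> q"
  shows "p * q' + p' * q \<le> p * q + p' * q'"
proof -
  from assms obtain a b where "p = p' + a" "q = q' + b"
    by (meson le_iff_add)
  then have "p * q + p' * q' = (p * q' + p' * q) + a * b"
    by (simp add: algebra_simps)
  then show ?thesis by simp
qed

lemma nn_integral_reflect:
  fixes t :: real
  assumes [measurable]: "f \<in> borel_measurable borel"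
  shows "(\<integral>\<^sup>+z. f z \<partial>lborel) = (\<integral>\<^sup>+z. f (t - z) \<partial>lborel)"
  using nn_integral_real_affine[of f "-1" t] by simp

text \<open>The order 2 case of the basic composition formula. Products of integrals become double
  integrals over \<open>s\<close> and \<open>t\<close>; adding the copy with \<open>s\<close> and
  \<open>t\<close> exchanged makes the inequality hold pointwise, by rearrangement.\<close>

lemma PF2_convolution:
  assumes f: "PF2 f" and h: "PF2 h"
    and [measurable]: "f \<in> borel_measurable borel" "h \<in> borel_measurable borel"
  shows "PF2 (\<lambda>x. \<integral>\<^sup>+z. f z * h (x - z) \<partial>lborel)"
  unfolding PF2_def
proof (intro allI impI)
  fix x1 x2 y1 y2 :: real
  assume x: "x1 \<le> x2" and y: "y1 \<le> y2"
  \<comment> \<open>The substitution \<open>z = x - s\<close> turns the convolution into a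
    composition of kernels with intermediate point \<open>s\<close>.\<close>
  have conv: "(\<integral>\<^sup>+z. f z * h (x - y - z) \<partial>lborel) = (\<integral>\<^sup>+s. f (x - s) * h (s - y) \<partial>lborel)" for x y
    by (subst nn_integral_reflect[where t = x]) (auto simp: algebra_simps)
  have double: "2 * ((\<integral>\<^sup>+s. u s \<partial>lborel) * (\<integral>\<^sup>+t. v t \<partial>lborel))
      = (\<integral>\<^sup>+s. \<integral>\<^sup>+t. u s * v t + u t * v s \<partial>lborel \<partial>lborel)"
    if [measurable]: "u \<in> borel_measurable borel" "v \<in> borel_measurable borel"
    for u v :: "real \<Rightarrow> ennreal"
  proof -
    have "(\<integral>\<^sup>+s. \<integral>\<^sup>+t. u s * v t + u t * v s \<partial>lborel \<partial>lborel)
      = (\<integral>\<^sup>+s. u s \<partial>lborel) * (\<integral>\<^sup>+t. v t \<partial>lborel) + (\<integral>\<^sup>+s. u s \<partial>lborel) * (\<integral>\<^sup>+t. v t \<partial>lborel)"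
      by (simp add: nn_integral_add nn_integral_cmult nn_integral_multc)
    then show ?thesis by (simp add: mult_2)
  qed
  \<comment> \<open>Each kernel gives one comparison of products. Passing from
    \<open>s \<le> t\<close> to \<open>t \<le> s\<close> reverses both comparisons, so the
    inequality keeps its direction.\<close>
  have pw: "f (x1 - s) * h (s - y2) * (f (x2 - t) * h (t - y1))
        + f (x1 - t) * h (t - y2) * (f (x2 - s) * h (s - y1))
      \<le> f (x1 - s) * h (s - y1) * (f (x2 - t) * h (t - y2))
        + f (x1 - t) * h (t - y1) * (f (x2 - s) * h (s - y2))" for s t
  proof (cases "s \<le> t")
    case True
    show ?thesis
      using ennreal_rearrangement[OF PF2D[OF f x True] PF2D[OF h True y]]
      by (simp add: mult_ac add_ac)
  next
    case False
    then have "t \<le> s" by simp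
    show ?thesis
      using ennreal_rearrangement[OF PF2D[OF f x \<open>t \<le> s\<close>] PF2D[OF h \<open>t \<le> s\<close> y]]
      by (simp add: mult_ac add_ac)
  qed
  have "2 * ((\<integral>\<^sup>+z. f z * h (x1 - y2 - z) \<partial>lborel) * (\<integral>\<^sup>+z. f z * h (x2 - y1 - z) \<partial>lborel))
     \<le> 2 * ((\<integral>\<^sup>+z. f z * h (x1 - y1 - z) \<partial>lborel) * (\<integral>\<^sup>+z. f z * h (x2 - y2 - z) \<partial>lborel))"
    unfolding conv by (subst (1 2) double) (auto intro!: nn_integral_mono pw)
  then show "(\<integral>\<^sup>+z. f z * h (x1 - y2 - z) \<partial>lborel) * (\<integral>\<^sup>+z. f z * h (x2 - y1 - z) \<partial>lborel)
     \<le> (\<integral>\<^sup>+z. f z * h (x1 - y1 - z) \<partial>lborel) * (\<integral>\<^sup>+z. f z * h (x2 - y2 - z) \<partial>lborel)"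
    by (subst (asm) ennreal_mult_le_mult_iff) auto
qed

text \<open>The product on the left is a fourfold integral. \<open>PF2 G\<close> bounds its
  integrand by one that splits again once the variables are paired as \<open>a\<close>,
  \<open>d\<close> and \<open>b\<close>, \<open>c\<close>.\<close>

lemma PF2_signed_log_concave:
  assumes G: "PF2 G"
    and [measurable]: "G \<in> borel_measurable borel" "g \<in> borel_measurable borel"
    and supp: "\<And>z. z < 0 \<Longrightarrow> g z = 0"
  defines "g' \<equiv> \<lambda>z. g (- z)"
  shows "(\<integral>\<^sup>+a. g' a * (\<integral>\<^sup>+b. g' b * G (0 - a - b) \<partial>lborel) \<partial>lborel)
       * (\<integral>\<^sup>+a. g a * (\<integral>\<^sup>+b. g b * G (0 - a - b) \<partial>lborel) \<partial>lborel)
     \<le> (\<integral>\<^sup>+a. g' a * (\<integral>\<^sup>+b. g b * G (0 - a - b) \<partial>lborel) \<partial>lborel)\<^sup>2"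
proof -
  have refl: "(\<integral>\<^sup>+z. u z \<partial>lborel) = (\<integral>\<^sup>+z. u (- z) \<partial>lborel)"
    if "u \<in> borel_measurable borel" for u :: "real \<Rightarrow> ennreal"
    using nn_integral_reflect[OF that, of 0] by simp
  have B: "(\<integral>\<^sup>+a. g' a * (\<integral>\<^sup>+b. g' b * G (0 - a - b) \<partial>lborel) \<partial>lborel)
      = (\<integral>\<^sup>+a. \<integral>\<^sup>+b. g a * g b * G (a + b) \<partial>lborel \<partial>lborel)"
    unfolding g'_def by (subst refl, simp, subst (2) refl) (simp_all add: nn_integral_cmult mult.assoc)
  have C: "(\<integral>\<^sup>+a. g a * (\<integral>\<^sup>+b. g b * G (0 - a - b) \<partial>lborel) \<partial>lborel)
      = (\<integral>\<^sup>+c. \<integral>\<^sup>+d. g c * g d * G (- c - d) \<partial>lborel \<partial>lborel)"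
    by (simp add: nn_integral_cmult mult.assoc)
  have A: "(\<integral>\<^sup>+a. g' a * (\<integral>\<^sup>+b. g b * G (0 - a - b) \<partial>lborel) \<partial>lborel)
      = (\<integral>\<^sup>+a. \<integral>\<^sup>+d. g a * g d * G (a - d) \<partial>lborel \<partial>lborel)"
    unfolding g'_def by (subst refl) (simp_all add: nn_integral_cmult mult.assoc)
  have pw: "g a * g b * G (a + b) * (g c * g d * G (- c - d))
      \<le> g a * g d * G (a - d) * (g b * g c * G (b - c))" for a b c d
  proof (cases "a < 0 \<or> b < 0 \<or> c < 0 \<or> d < 0")
    case True
    then show ?thesis by (auto simp: supp)
  next
    case False
    \<comment> \<open>\<open>PF2\<close> at \<open>- c \<le> a\<close> and
      \<open>- b \<le> d\<close>; nonnegativity of the four variables gives this order.\<close>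
    then have "G (- c - d) * G (a - (- b)) \<le> G (- c - (- b)) * G (a - d)"
      by (intro PF2D[OF G]) auto
    then have "(g a * g b * g c * g d) * (G (- c - d) * G (a + b))
        \<le> (g a * g b * g c * g d) * (G (b - c) * G (a - d))"
      by (intro mult_left_mono) (auto simp: add.commute)
    then show ?thesis by (simp add: mult_ac)
  qed
  let ?I = "\<lambda>F. \<integral>\<^sup>+a. \<integral>\<^sup>+b. \<integral>\<^sup>+c. \<integral>\<^sup>+d. F a b c d \<partial>lborel \<partial>lborel \<partial>lborel \<partial>(lborel :: real measure)"
  have "(\<integral>\<^sup>+a. \<integral>\<^sup>+b. g a * g b * G (a + b) \<partial>lborel \<partial>lborel)
      * (\<integral>\<^sup>+c. \<integral>\<^sup>+d. g c * g d * G (- c - d) \<partial>lborel \<partial>lborel)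
    = ?I (\<lambda>a b c d. g a * g b * G (a + b) * (g c * g d * G (- c - d)))"
    by (simp add: nn_integral_multc nn_integral_cmult)
  also have "\<dots> \<le> ?I (\<lambda>a b c d. g a * g d * G (a - d) * (g b * g c * G (b - c)))"
    by (intro nn_integral_mono pw)
  \<comment> \<open>Each factor involves two of the nested variables, so constants can be pulled out
    without exchanging integrals; the integral over \<open>b\<close> and \<open>c\<close> is a
    renamed copy of the one over \<open>a\<close> and \<open>d\<close>.\<close>
  also have "\<dots> = (\<integral>\<^sup>+a. \<integral>\<^sup>+d. g a * g d * G (a - d) \<partial>lborel \<partial>lborel)\<^sup>2"
    by (simp add: power2_eq_square nn_integral_multc nn_integral_cmult)
  finally show ?thesis unfolding A B C .
qed

section \<open>Iterated convolutions\<close>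

text \<open>The convolution of all \<open>f i\<close> and \<open>l\<close> at \<open>x\<close>. The
  factor \<open>l\<close> takes the coordinate that is determined once the total is fixed at
  \<open>x\<close>; a single integral over the product space is the shape that the probability
  computation produces.\<close>

definition iter_conv :: "'i set \<Rightarrow> ('i \<Rightarrow> real \<Rightarrow> ennreal) \<Rightarrow> (real \<Rightarrow> ennreal) \<Rightarrow> real \<Rightarrow> ennreal" where
  "iter_conv I f l x = (\<integral>\<^sup>+z. (\<Prod>i\<in>I. f i (z i)) * l (x - (\<Sum>i\<in>I. z i)) \<partial>PiM I (\<lambda>_. lborel))"

interpretation lborels: product_sigma_finite "\<lambda>_. lborel :: real measure"
  by standard

lemma iter_conv_empty [simp]: "iter_conv {} f l = l"
  by (simp add: iter_conv_def fun_eq_iff PiM_empty nn_integral_count_space_finite)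

text \<open>Fubini with coordinate \<open>j\<close> outermost. This recursion drives the inductions
  below and later isolates the factors \<open>k\<close> and \<open>k + 1\<close>.\<close>

lemma iter_conv_insert:
  assumes I: "finite I" "j \<notin> I"
    and f [measurable]: "\<And>i. f i \<in> borel_measurable borel" and [measurable]: "l \<in> borel_measurable borel"
  shows "iter_conv (insert j I) f l x = (\<integral>\<^sup>+z. f j z * iter_conv I f l (x - z) \<partial>lborel)"
proof -
  have 1: "(\<Prod>i\<in>I. f i ((z(j := y)) i)) = (\<Prod>i\<in>I. f i (z i))" for z y
    using I by (intro prod.cong) auto
  have 2: "(\<Sum>i\<in>I. (z(j := y)) i) = (\<Sum>i\<in>I. z i)" for z :: "_ \<Rightarrow> real" and y
    using I by (intro sum.cong) auto
  show ?thesis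
    unfolding iter_conv_def
    using I by (subst lborels.product_nn_integral_insert_rev)
      (simp_all del: fun_upd_apply add: 1 2 nn_integral_cmult[symmetric] mult.assoc diff_diff_eq, simp)
qed

lemma measurable_iter_conv [measurable]:
  assumes "finite I"
    and f [measurable]: "\<And>i. f i \<in> borel_measurable borel" and [measurable]: "l \<in> borel_measurable borel"
  shows "iter_conv I f l \<in> borel_measurable borel"
  using \<open>finite I\<close>
proof induction
  case (insert j I)
  note [measurable] = insert.IH
  have "iter_conv (insert j I) f l = (\<lambda>x. \<integral>\<^sup>+z. f j z * iter_conv I f l (x - z) \<partial>lborel)"
    using insert by (simp add: fun_eq_iff iter_conv_insert)
  then show ?case by simp
qed simp

lemma PF2_iter_conv:
  assumes "finite I" and "\<And>i. PF2 (f i)" "PF2 l"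
    and f [measurable]: "\<And>i. f i \<in> borel_measurable borel" and [measurable]: "l \<in> borel_measurable borel"
  shows "PF2 (iter_conv I f l)"
  using \<open>finite I\<close>
proof induction
  case (insert j I)
  have "iter_conv (insert j I) f l = (\<lambda>x. \<integral>\<^sup>+z. f j z * iter_conv I f l (x - z) \<partial>lborel)"
    using insert by (simp add: fun_eq_iff iter_conv_insert)
  then show ?case using insert assms by (simp add: PF2_convolution)
qed (simp add: assms)

lemma iter_conv_cong:
  assumes "\<And>i. i \<in> I \<Longrightarrow> f i = g i"
  shows "iter_conv I f l = iter_conv I g l"
  unfolding iter_conv_def using assms by (intro ext nn_integral_cong) simp

text \<open>Translations add up under convolution, and there are \<open>card I + 1\<close>
  translated factors because \<open>l\<close> counts as well.\<close>

lemma iter_conv_shift: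
  assumes "finite I"
    and f [measurable]: "\<And>i. f i \<in> borel_measurable borel" and [measurable]: "l \<in> borel_measurable borel"
  shows "iter_conv I (\<lambda>i z. f i (z - m)) (\<lambda>z. l (z - m)) x = iter_conv I f l (x - (real (card I) + 1) * m)"
  using \<open>finite I\<close>
proof (induction arbitrary: x)
  case (insert j I)
  have "iter_conv (insert j I) (\<lambda>i z. f i (z - m)) (\<lambda>z. l (z - m)) x
     = (\<integral>\<^sup>+z. f j (z - m) * iter_conv I f l (x - z - (real (card I) + 1) * m) \<partial>lborel)"
    using insert by (simp add: iter_conv_insert)
  also have "\<dots> = (\<integral>\<^sup>+z. f j z * iter_conv I f l (x - (real (card I) + 2) * m - z) \<partial>lborel)"
    using insert(1) by (subst nn_integral_real_affine[of _ 1 m]) (auto simp: algebra_simps)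
  also have "\<dots> = iter_conv (insert j I) f l (x - (real (card (insert j I)) + 1) * m)"
    using insert by (simp add: iter_conv_insert algebra_simps)
  finally show ?case .
qed simp

section \<open>Gaussian samples and their deviations from the mean\<close>

text \<open>A finite product measure is determined by its values on boxes, where both sides factor
  into one-dimensional integrals.\<close>

lemma PiM_density:
  assumes "finite I" and [measurable]: "h \<in> borel_measurable borel"
    and "prob_space (density lborel h)"
  shows "PiM I (\<lambda>_. density lborel h) = density (PiM I (\<lambda>_. lborel)) (\<lambda>y. \<Prod>i\<in>I. h (y i :: real))"
proof -
  interpret D: prob_space "density lborel h" by fact
  interpret P: product_sigma_finite "\<lambda>_. density lborel h" by standard
  show ?thesis
  proof (rule P.PiM_eqI[OF \<open>finite I\<close>, symmetric])
    show "sets (density (PiM I (\<lambda>_. lborel)) (\<lambda>y. \<Prod>i\<in>I. h (y i))) = sets (PiM I (\<lambda>_. density lborel h))"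
      by (simp cong: sets_PiM_cong)
    fix A assume A: "\<And>i. i \<in> I \<Longrightarrow> A i \<in> sets (density lborel h)"
    then have [measurable]: "i \<in> I \<Longrightarrow> A i \<in> sets borel" for i by simp
    have "Pi\<^sub>E I A \<in> sets (PiM I (\<lambda>_. lborel))"
      using A \<open>finite I\<close> by (intro sets_PiM_I_finite) auto
    then have "emeasure (density (PiM I (\<lambda>_. lborel)) (\<lambda>y. \<Prod>i\<in>I. h (y i))) (Pi\<^sub>E I A)
      = (\<integral>\<^sup>+y. (\<Prod>i\<in>I. h (y i)) * indicator (Pi\<^sub>E I A) y \<partial>PiM I (\<lambda>_. lborel))"
      by (simp add: emeasure_density)
    also have "\<dots> = (\<integral>\<^sup>+y. (\<Prod>i\<in>I. h (y i) * indicator (A i) (y i)) \<partial>PiM I (\<lambda>_. lborel))"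
    proof (rule nn_integral_cong)
      fix y :: "'a \<Rightarrow> real" assume "y \<in> space (PiM I (\<lambda>_. lborel))"
      then have "indicator (Pi\<^sub>E I A) y = (\<Prod>i\<in>I. indicator (A i) (y i) :: ennreal)"
        using \<open>finite I\<close> by (auto simp: indicator_def space_PiM PiE_def Pi_def prod_zero_iff)
      then show "(\<Prod>i\<in>I. h (y i)) * indicator (Pi\<^sub>E I A) y = (\<Prod>i\<in>I. h (y i) * indicator (A i) (y i))"
        by (simp add: prod.distrib)
    qed
    also have "\<dots> = (\<Prod>i\<in>I. emeasure (density lborel h) (A i))"
      using \<open>finite I\<close> A by (subst lborels.product_nn_integral_prod) (auto simp: emeasure_density)
    finally show "emeasure (density (PiM I (\<lambda>_. lborel)) (\<lambda>y. \<Prod>i\<in>I. h (y i))) (Pi\<^sub>E I A)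
      = (\<Prod>i\<in>I. emeasure (density lborel h) (A i))" .
  qed
qed


text \<open>As \<open>m\<close> is the mean, the sum of squares is the sum of squared deviations
  plus \<open>card J * m\<^sup>2\<close>. This is the source of the independence of mean and
  deviations.\<close>

lemma prod_std_normal_density_split:
  assumes "finite J" "J \<noteq> {}"
    and sum: "(\<Sum>i\<in>J. y i) = real (card J) * m"
  shows "(\<Prod>i\<in>J. std_normal_density (y i))
    = exp (- (real (card J) * m\<^sup>2) / 2) * (\<Prod>i\<in>J. std_normal_density (y i - m))"
proof -
  have "(\<Sum>i\<in>J. (y i - m)\<^sup>2) = (\<Sum>i\<in>J. (y i)\<^sup>2) - 2 * m * (\<Sum>i\<in>J. y i) + real (card J) * m\<^sup>2"
  proof -
    have "(\<Sum>i\<in>J. (y i - m)\<^sup>2) = (\<Sum>i\<in>J. (y i)\<^sup>2 - 2 * m * y i + m\<^sup>2)"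
      by (simp add: power2_diff algebra_simps)
    then show ?thesis by (simp add: sum.distrib sum_subtractf sum_distrib_left)
  qed
  then have sq: "(\<Sum>i\<in>J. (y i)\<^sup>2) = (\<Sum>i\<in>J. (y i - m)\<^sup>2) + real (card J) * m\<^sup>2"
    unfolding sum by (simp add: power2_eq_square)
  have prod: "(\<Prod>i\<in>J. std_normal_density (u i))
      = (1 / sqrt (2 * pi)) ^ card J * exp (- (\<Sum>i\<in>J. (u i)\<^sup>2) / 2)" for u
    unfolding std_normal_density_def prod.distrib using \<open>finite J\<close>
    by (simp add: exp_sum[symmetric] sum_negf sum_divide_distrib[symmetric])
  show ?thesis
    unfolding prod sq by (simp add: exp_add[symmetric] add_divide_distrib diff_divide_distrib)
qed

text \<open>Once coordinate \<open>j\<close> is replaced by the mean \<open>m\<close>, the density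
  is a function of \<open>m\<close> times a function of the deviations, so the integral factors and
  the sets \<open>A i\<close> enter the convolution only.\<close>

lemma emeasure_deviations_from_mean:
  fixes M :: "'a measure" and Y :: "'i \<Rightarrow> 'a \<Rightarrow> real" and A :: "'i \<Rightarrow> real set"
  assumes M: "prob_space M" and I: "finite I" "j \<notin> I"
    and indep: "prob_space.indep_vars M (\<lambda>_. borel) Y (insert j I)"
    and dist: "\<And>i. i \<in> insert j I \<Longrightarrow> distributed M lborel (Y i) (\<lambda>x. ennreal (std_normal_density x))"
    and A [measurable]: "\<And>i. A i \<in> sets borel"
  defines "N \<equiv> real (card (insert j I))"
    and "f \<equiv> \<lambda>i z. ennreal (std_normal_density z) * indicator (A i) z"
  shows "emeasure M {\<omega> \<in> space M. \<forall>i\<in>insert j I. Y i \<omega> - (\<Sum>i\<in>insert j I. Y i \<omega>) / N \<in> A i}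
    = ennreal N * (\<integral>\<^sup>+m. ennreal (exp (- (N * m\<^sup>2) / 2)) \<partial>lborel) * iter_conv I f (f j) 0"
proof -
  interpret prob_space M by fact
  define J where "J = insert j I"
  have J: "finite J" "J \<noteq> {}" and N: "N > 0" "N = real (card J)" "N = real (card I) + 1"
    using I by (auto simp: J_def N_def)
  let ?\<phi> = "\<lambda>x. ennreal (std_normal_density x)"
  let ?E = "{y \<in> space (PiM J (\<lambda>_. borel)). \<forall>i\<in>J. y i - (\<Sum>i\<in>J. y i) / N \<in> A i}"
  let ?Y = "\<lambda>\<omega>. \<lambda>i\<in>J. Y i \<omega>"
  have f [measurable]: "f i \<in> borel_measurable borel" for i
    unfolding f_def by measurable
  have Y [measurable]: "i \<in> J \<Longrightarrow> Y i \<in> borel_measurable M" for i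
    using dist[of i] by (auto simp: J_def distributed_def)
  have Y' [measurable]: "?Y \<in> measurable M (PiM J (\<lambda>_. borel))"
    by (intro measurable_restrict Y)
  have \<phi>: "prob_space (density lborel ?\<phi>)"
    using prob_space_normal_density[of 1 0] by simp
  have distr: "distr M borel (Y i) = density lborel ?\<phi>" if "i \<in> J" for i
    using distributed_distr_eq_density[OF dist[of i]] that by (simp add: J_def cong: distr_cong)
  have E [measurable]: "?E \<in> sets (PiM J (\<lambda>_. borel))"
  proof -
    have [measurable]: "(\<lambda>y. y i - (\<Sum>i\<in>J. y i) / N) \<in> borel_measurable (PiM J (\<lambda>_. borel))"
      if "i \<in> J" for i
      using that by measurable
    have [measurable]: "Measurable.pred (PiM J (\<lambda>_. borel)) (\<lambda>y. y i - (\<Sum>i\<in>J. y i) / N \<in> A i)"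
      if "i \<in> J" for i
      using that by measurable
    show ?thesis using J(1) by measurable
  qed
  have F [measurable]: "(\<lambda>y. \<Prod>i\<in>J. ?\<phi> (y i) * indicator (A i) (y i - (\<Sum>i\<in>J. y i) / N))
      \<in> borel_measurable (PiM J (\<lambda>_. lborel))"
    by measurable
  have "emeasure M {\<omega> \<in> space M. \<forall>i\<in>J. Y i \<omega> - (\<Sum>i\<in>J. Y i \<omega>) / N \<in> A i}
      = emeasure (distr M (PiM J (\<lambda>_. borel)) ?Y) ?E"
    by (subst emeasure_distr[OF Y' E]) (auto intro!: arg_cong[where f = "emeasure M"] simp: space_PiM)
  also have "distr M (PiM J (\<lambda>_. borel)) ?Y = PiM J (\<lambda>i. distr M borel (Y i))"
    using indep_vars_iff_distr_eq_PiM'[where I = J and M' = "\<lambda>_. borel" and X = Y] indep J Y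
    by (simp add: J_def)
  also have "\<dots> = PiM J (\<lambda>_. density lborel ?\<phi>)"
    by (intro PiM_cong refl distr)
  also have "\<dots> = density (PiM J (\<lambda>_. lborel)) (\<lambda>y. \<Prod>i\<in>J. ?\<phi> (y i))"
    using J \<phi> by (intro PiM_density) auto
  also have "emeasure \<dots> ?E = (\<integral>\<^sup>+y. (\<Prod>i\<in>J. ?\<phi> (y i)) * indicator ?E y \<partial>PiM J (\<lambda>_. lborel))"
    using E by (intro emeasure_density) (auto cong: sets_PiM_cong)
  also have "\<dots> = (\<integral>\<^sup>+y. (\<Prod>i\<in>J. ?\<phi> (y i) * indicator (A i) (y i - (\<Sum>i\<in>J. y i) / N)) \<partial>PiM J (\<lambda>_. lborel))"
  proof (rule nn_integral_cong)
    fix y :: "'i \<Rightarrow> real" assume "y \<in> space (PiM J (\<lambda>_. lborel))"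
    then have "indicator ?E y = (\<Prod>i\<in>J. indicator (A i) (y i - (\<Sum>i\<in>J. y i) / N) :: ennreal)"
      using J by (auto simp: indicator_def space_PiM prod_zero_iff)
    then show "(\<Prod>i\<in>J. ?\<phi> (y i)) * indicator ?E y
        = (\<Prod>i\<in>J. ?\<phi> (y i) * indicator (A i) (y i - (\<Sum>i\<in>J. y i) / N))"
      by (simp add: prod.distrib)
  qed
  \<comment> \<open>Coordinate \<open>j\<close> goes innermost, to be substituted while the others
    are fixed.\<close>
  also have "\<dots> = (\<integral>\<^sup>+y. \<integral>\<^sup>+t. (\<Prod>i\<in>J. ?\<phi> ((y(j := t)) i)
      * indicator (A i) ((y(j := t)) i - (\<Sum>i\<in>J. (y(j := t)) i) / N)) \<partial>lborel \<partial>PiM I (\<lambda>_. lborel))"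
    using F unfolding J_def by (intro lborels.product_nn_integral_insert I)
  \<comment> \<open>The substitution is \<open>t = N * m - s\<close>, with \<open>s\<close> the sum
    of the other coordinates; then \<open>m\<close> is the mean of all of them and \<open>N\<close>
    is the Jacobian.\<close>
  also have "\<dots> = (\<integral>\<^sup>+y. \<integral>\<^sup>+m. ennreal N * (ennreal (exp (- (N * m\<^sup>2) / 2)) *
      ((\<Prod>i\<in>I. f i (y i - m)) * f j (N * m - (\<Sum>i\<in>I. y i) - m))) \<partial>lborel \<partial>PiM I (\<lambda>_. lborel))"
  proof (rule nn_integral_cong)
    fix y :: "'i \<Rightarrow> real" assume y: "y \<in> space (PiM I (\<lambda>_. lborel))"
    define s where "s = (\<Sum>i\<in>I. y i)"
    have sum: "(\<Sum>i\<in>J. (y(j := t)) i) = t + s" for t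
    proof -
      have "(\<Sum>i\<in>I. (y(j := t)) i) = s" unfolding s_def using I by (intro sum.cong) auto
      then show ?thesis unfolding J_def using I by simp
    qed
    let ?F = "\<lambda>t. \<Prod>i\<in>J. ?\<phi> ((y(j := t)) i) * indicator (A i) ((y(j := t)) i - (\<Sum>i\<in>J. (y(j := t)) i) / N)"
    have F_t: "?F \<in> borel_measurable borel"
      unfolding sum by (auto simp: fun_upd_apply)
    have eq: "?F (- s + N * m) = ennreal (exp (- (N * m\<^sup>2) / 2)) *
        ((\<Prod>i\<in>I. f i (y i - m)) * f j (N * m - s - m))" (is "_ = ?r") for m
    proof -
      let ?z = "y(j := - s + N * m)"
      have "?F (- s + N * m) = (\<Prod>i\<in>J. ?\<phi> (?z i)) * (\<Prod>i\<in>J. indicator (A i) (?z i - m))"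
        using N by (simp only: sum prod.distrib) simp
      also have "(\<Prod>i\<in>J. ?\<phi> (?z i)) = ennreal (exp (- (N * m\<^sup>2) / 2)) * (\<Prod>i\<in>J. ?\<phi> (?z i - m))"
        using prod_std_normal_density_split[OF J, of ?z m] sum N(2)
        by (simp del: fun_upd_apply add: prod_ennreal prod_nonneg ennreal_mult'[symmetric])
      also have "\<dots> * (\<Prod>i\<in>J. indicator (A i) (?z i - m))
          = ennreal (exp (- (N * m\<^sup>2) / 2)) * (\<Prod>i\<in>J. f i (?z i - m))"
        by (simp del: fun_upd_apply add: f_def prod.distrib mult.assoc)
      also have "(\<Prod>i\<in>J. f i (?z i - m)) = f j (N * m - s - m) * (\<Prod>i\<in>I. f i (y i - m))"
      proof -
        have "(\<Prod>i\<in>I. f i (?z i - m)) = (\<Prod>i\<in>I. f i (y i - m))"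
          using I by (intro prod.cong) auto
        then show ?thesis unfolding J_def using I by simp
      qed
      finally show ?thesis by (simp add: mult.commute)
    qed
    have "(\<integral>\<^sup>+t. ?F t \<partial>lborel) = ennreal N * (\<integral>\<^sup>+m. ?F (- s + N * m) \<partial>lborel)"
      using N(1) by (subst nn_integral_real_affine[OF F_t, of N "- s"]) (simp_all del: fun_upd_apply)
    also have "\<dots> = (\<integral>\<^sup>+m. ennreal N * ?r m \<partial>lborel)"
      unfolding eq by (simp add: nn_integral_cmult)
    finally show "(\<integral>\<^sup>+t. ?F t \<partial>lborel) = (\<integral>\<^sup>+m. ennreal N * (ennreal (exp (- (N * m\<^sup>2) / 2)) *
      ((\<Prod>i\<in>I. f i (y i - m)) * f j (N * m - (\<Sum>i\<in>I. y i) - m))) \<partial>lborel)"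
      unfolding s_def .
  qed
  \<comment> \<open>Integrating over \<open>y\<close> first, for fixed \<open>m\<close>, yields a
    convolution of translated factors at \<open>N * m\<close>.\<close>
  also have "\<dots> = (\<integral>\<^sup>+m. \<integral>\<^sup>+y. ennreal N * (ennreal (exp (- (N * m\<^sup>2) / 2)) *
      ((\<Prod>i\<in>I. f i (y i - m)) * f j (N * m - (\<Sum>i\<in>I. y i) - m))) \<partial>PiM I (\<lambda>_. lborel) \<partial>lborel)"
  proof -
    interpret P: pair_sigma_finite "lborel :: real measure" "PiM I (\<lambda>_. lborel :: real measure)"
      by (intro pair_sigma_finite.intro lborels.sigma_finite I sigma_finite_lborel)
    show ?thesis by (rule P.Fubini') measurable
  qed
  also have "\<dots> = (\<integral>\<^sup>+m. ennreal N * (ennreal (exp (- (N * m\<^sup>2) / 2)) *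
      iter_conv I (\<lambda>i z. f i (z - m)) (\<lambda>z. f j (z - m)) (N * m)) \<partial>lborel)"
    unfolding iter_conv_def
    by (intro nn_integral_cong) (subst nn_integral_cmult, measurable)+
  \<comment> \<open>The total translation is also \<open>N * m\<close>, so the convolution is
    evaluated at 0 for every \<open>m\<close>.\<close>
  also have "\<dots> = (\<integral>\<^sup>+m. ennreal N * (ennreal (exp (- (N * m\<^sup>2) / 2)) * iter_conv I f (f j) 0) \<partial>lborel)"
    by (simp add: iter_conv_shift[OF I(1) f f] N(3))
  also have "\<dots> = ennreal N * (\<integral>\<^sup>+m. ennreal (exp (- (N * m\<^sup>2) / 2)) \<partial>lborel) * iter_conv I f (f j) 0"
    by (simp add: nn_integral_cmult nn_integral_multc mult.assoc)
  finally show ?thesis unfolding J_def .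
qed


section \<open>Truncated normal densities and log-concavity of the sequence\<close>

text \<open>The exponents of the two sides differ by \<open>(x2 - x1) * (y2 - y1)\<close>, and both
  arguments on the right lie between \<open>x1 - y2\<close> and \<open>x2 - y1\<close>, hence in
  \<open>A\<close> whenever these do.\<close>

lemma PF2_normal_restrict:
  assumes "is_interval A"
  shows "PF2 (\<lambda>z. ennreal (std_normal_density z) * indicator A z)"
  unfolding PF2_def
proof (intro allI impI)
  fix x1 x2 y1 y2 :: real
  assume x: "x1 \<le> x2" and y: "y1 \<le> y2"
  have "0 \<le> (x2 - x1) * (y2 - y1)" using x y by simp
  then have "- (x1 - y2)\<^sup>2 / 2 + - (x2 - y1)\<^sup>2 / 2 \<le> - (x1 - y1)\<^sup>2 / 2 + - (x2 - y2)\<^sup>2 / 2"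
    by (simp add: power2_eq_square field_simps)
  then have "std_normal_density (x1 - y2) * std_normal_density (x2 - y1)
      \<le> std_normal_density (x1 - y1) * std_normal_density (x2 - y2)"
    unfolding std_normal_density_def
    by (simp add: divide_right_mono flip: exp_add)
  then have "ennreal (std_normal_density (x1 - y2)) * ennreal (std_normal_density (x2 - y1))
      \<le> ennreal (std_normal_density (x1 - y1)) * ennreal (std_normal_density (x2 - y2))"
    by (simp add: ennreal_leI flip: ennreal_mult'')
  moreover have "x1 - y1 \<in> A \<and> x2 - y2 \<in> A" if "x1 - y2 \<in> A" "x2 - y1 \<in> A"
    using mem_is_interval_1_I[OF assms that] x y by simp
  ultimately show "ennreal (std_normal_density (x1 - y2)) * indicator A (x1 - y2) *
      (ennreal (std_normal_density (x2 - y1)) * indicator A (x2 - y1))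
    \<le> ennreal (std_normal_density (x1 - y1)) * indicator A (x1 - y1) *
      (ennreal (std_normal_density (x2 - y2)) * indicator A (x2 - y2))"
    by (auto simp: indicator_def)
qed

theorem theorem1p3:
  fixes M :: "'a measure" and Y :: "nat \<Rightarrow> 'a \<Rightarrow> real" and n :: nat
  assumes "prob_space M"
    and "n \<ge> 3"
    and "prob_space.indep_vars M (\<lambda>_. borel) Y {1..n}"
    and "\<And>i. i \<in> {1..n} \<Longrightarrow> distributed M lborel (Y i) (\<lambda>x. ennreal (std_normal_density x))"
  shows "log_concave_upto n (mean_rank_prob M n Y)"
  unfolding log_concave_upto_def
proof
  interpret prob_space M by fact
  let ?q = "mean_rank_prob M n Y"
  fix k assume k: "k \<in> {1..n-1}"
  \<comment> \<open>A third index, available since \<open>n \<ge> 3\<close>. Its factor serves as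
    the last one in \<open>G\<close>, which covers the case \<open>n = 3\<close> where
    \<open>I\<close> is empty.\<close>
  obtain j where j: "j \<in> {1..n}" "j \<noteq> k" "j \<noteq> k + 1"
  proof
    show "(if k = 1 then 3 else 1) \<in> {1..n}" "(if k = 1 then 3 else 1) \<noteq> k"
      "(if k = 1 then 3 else 1) \<noteq> k + 1"
      using k \<open>n \<ge> 3\<close> by auto
  qed
  define I where "I = {1..n} - {j, k, k + 1}"
  have I: "finite I" "k \<notin> insert (k + 1) I" "k + 1 \<notin> I" "j \<notin> insert k (insert (k + 1) I)"
    and n: "insert j (insert k (insert (k + 1) I)) = {1..n}"
    using j k by (auto simp: I_def)
  \<comment> \<open>The half-line required of the deviation of sample \<open>i\<close> from the
    mean; 0 belongs to both choices because the event has non-strict inequalities.\<close>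
  define A where "A r i = (if i \<le> r then {..0} else {0..} :: real set)" for r i :: nat
  define f where "f r i z = ennreal (std_normal_density z) * indicator (A r i) z" for r i z
  define c where "c = ennreal (real n) * (\<integral>\<^sup>+m. ennreal (exp (- (real n * m\<^sup>2) / 2)) \<partial>lborel)"
  have A [measurable]: "A r i \<in> sets borel" for r i
    by (simp add: A_def)
  have f [measurable]: "f r i \<in> borel_measurable borel" for r i
    unfolding f_def by measurable
  have f_PF2: "PF2 (f r i)" for r i
    unfolding f_def by (intro PF2_normal_restrict) (simp add: A_def is_interval_ic is_interval_ci)
  define G where "G = iter_conv I (f k) (f k j)"
  have G: "PF2 G" "G \<in> borel_measurable borel"
    unfolding G_def using I(1) by (auto intro!: PF2_iter_conv f_PF2 f)
  have q: "ennreal (?q r) = c * (\<integral>\<^sup>+a. f r k a * (\<integral>\<^sup>+b. f r (k + 1) b * G (0 - a - b) \<partial>lborel) \<partial>lborel)"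
    if r: "r \<in> {k - 1, k, k + 1}" for r
  proof -
    \<comment> \<open>Among the three values of \<open>r\<close>, only samples \<open>k\<close> and
      \<open>k + 1\<close> ever change sides, so one \<open>G\<close> serves all three
      probabilities.\<close>
    have A_r: "A r i = A k i" if "i \<in> insert j I" for i
      using that r j by (auto simp: A_def I_def)
    have ball_split: "(\<forall>i\<in>{1..n}. P i) \<longleftrightarrow> (\<forall>i\<in>{1..r}. P i) \<and> (\<forall>i\<in>{r+1..n}. P i)" for P
    proof -
      have "{1..n} = {1..r} \<union> {r+1..n}" using r k by auto
      then show ?thesis by (simp only: ball_Un)
    qed
    have "(\<forall>i\<in>{1..r}. Y i \<omega> \<le> sample_mean n Y \<omega>) \<and> (\<forall>i\<in>{r+1..n}. sample_mean n Y \<omega> \<le> Y i \<omega>)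
      \<longleftrightarrow> (\<forall>i\<in>{1..n}. Y i \<omega> - (\<Sum>i\<in>{1..n}. Y i \<omega>) / real n \<in> A r i)" for \<omega>
      by (subst ball_split) (auto simp: A_def sample_mean_def)
    then have "ennreal (?q r) = emeasure M
        {\<omega> \<in> space M. \<forall>i\<in>{1..n}. Y i \<omega> - (\<Sum>i\<in>{1..n}. Y i \<omega>) / real n \<in> A r i}"
      by (simp add: mean_rank_prob_def emeasure_eq_measure)
    also have "\<dots> = c * iter_conv (insert k (insert (k + 1) I)) (f r) (f r j) 0"
      using emeasure_deviations_from_mean[of M "insert k (insert (k + 1) I)" j Y "A r"] assms I
      unfolding n by (simp add: c_def f_def[abs_def])
    also have "iter_conv (insert k (insert (k + 1) I)) (f r) (f r j) 0 =
        (\<integral>\<^sup>+a. f r k a * (\<integral>\<^sup>+b. f r (k + 1) b * iter_conv I (f r) (f r j) (0 - a - b) \<partial>lborel) \<partial>lborel)"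
      using I by (simp add: iter_conv_insert)
    also have "iter_conv I (f r) (f r j) = iter_conv I (f k) (f k j)"
    proof -
      have "f r i = f k i" if "i \<in> insert j I" for i
        using A_r[OF that] by (simp add: f_def fun_eq_iff)
      then show ?thesis using iter_conv_cong[of I "f r" "f k"] by simp
    qed
    finally show ?thesis unfolding G_def .
  qed
  let ?g = "\<lambda>z. ennreal (std_normal_density z) * indicator {0..} z"
  \<comment> \<open>The normal density is even, so reflecting \<open>?g\<close> only moves its
    support to the negative half-line.\<close>
  have g': "?g (- z) = ennreal (std_normal_density z) * indicator {..0} z" for z
    by (simp add: std_normal_density_def indicator_def)
  define T where "T u v = (\<integral>\<^sup>+a. u a * (\<integral>\<^sup>+b. v b * G (0 - a - b) \<partial>lborel) \<partial>lborel)"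
    for u v :: "real \<Rightarrow> ennreal"
  have "f (k + 1) k = (\<lambda>z. ?g (- z))" "f (k + 1) (k + 1) = (\<lambda>z. ?g (- z))"
    "f k k = (\<lambda>z. ?g (- z))" "f k (k + 1) = ?g" "f (k - 1) k = ?g" "f (k - 1) (k + 1) = ?g"
    unfolding g' using k by (auto simp: f_def A_def fun_eq_iff)
  then have q': "ennreal (?q (k + 1)) = c * T (\<lambda>z. ?g (- z)) (\<lambda>z. ?g (- z))"
    "ennreal (?q k) = c * T (\<lambda>z. ?g (- z)) ?g" "ennreal (?q (k - 1)) = c * T ?g ?g"
    using q[of "k + 1"] q[of k] q[of "k - 1"] by (simp_all add: T_def)
  have "T (\<lambda>z. ?g (- z)) (\<lambda>z. ?g (- z)) * T ?g ?g \<le> (T (\<lambda>z. ?g (- z)) ?g)\<^sup>2"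
    unfolding T_def by (rule PF2_signed_log_concave[OF G]) auto
  then have "c\<^sup>2 * (T (\<lambda>z. ?g (- z)) (\<lambda>z. ?g (- z)) * T ?g ?g) \<le> c\<^sup>2 * (T (\<lambda>z. ?g (- z)) ?g)\<^sup>2"
    by (intro mult_left_mono) auto
  then have "ennreal (?q (k + 1)) * ennreal (?q (k - 1)) \<le> (ennreal (?q k))\<^sup>2"
    unfolding q' by (simp add: power2_eq_square mult_ac)
  moreover have "?q r \<ge> 0" for r by (simp add: mean_rank_prob_def)
  ultimately show "(?q k)\<^sup>2 \<ge> ?q (k + 1) * ?q (k - 1)"
    by (simp add: ennreal_power flip: ennreal_mult)
qed

end
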